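(* Let $N\geq 1$ be an integer, let $\alpha$ be a real constant with $\alpha<-\frac{N+1}{N}$, let $p(n)=n^\alpha$, and let $G\sim\vec{G}(n,p(n))$ be an Erdős–Rényi random directed graph. For $k\ge 1$ let $\vec\beta_k(G)$ denote the $k$-th Betti number of its non-regular path homology. Then for every $k\geq N$, $\vec\beta_k(G)=0$ with high probability. The same result holds with $\vec\beta_k(G)$ replaced by the $k$-th Betti number $\vec\beta^{\mathrm{reg}}_k(G)$ of regular path homology.
   Context: A simple digraph is $G=(V,E)$ with $E\subseteq\{(i,j)\in V\times V: i\neq j\}$ (both $(i,j)$ and $(j,i)$ may be present). $\vec{G}(n,p)$ is the random simple digraph on vertex set $\{1,\dots,n\}$ in which each of the $n(n-1)$ possible directed edges is present independently with probability $p$. A property holds with high probability if its probability tends to $1$ as $n\to\infty$. Path homology (coefficients in $\mathbb{Z}$). For $m\ge 0$ let $\Lambda_m$ be the free $\mathbb{Z}$-module with basis $e_{v_0\dots v_m}$ over all sequences of $m+1$ vertices, and let $\mathcal{A}_m\subseteq\Lambda_m$ be the submodule spanned by the allowed sequences, i.e. those with $(v_i,v_{i+1})\in E$ for all $i$. Put $\Lambda_{-1}=\mathcal{A}_{-1}=\mathbb{Z}$. For $m\geq 1$ let $\partial_m:\Lambda_m\to\Lambda_{m-1}$, $\partial_m(e_{v_0\dots v_m})=\sum_{i=0}^m(-1)^i e_{v_0\dots\hat{v_i}\dots v_m}$, and let $\partial_0:\Lambda_0\to\mathbb{Z}$ be the sum of coefficients. Let $\Omega_m=\{v\in\mathcal{A}_m:\partial_m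 v\in\mathcal{A}_{m-1}\}$ for $m\ge0$ and $\Omega_{-1}=\mathbb{Z}$. The non-regular chain complex is $\cdots\to\Omega_2\to\Omega_1\to\Omega_0\to\mathbb{Z}\to0$ with the restrictions of $\partial_m$; its homology is non-regular path homology and $\vec\beta_k(G)=\operatorname{rank}(\ker\partial_k/\operatorname{im}\partial_{k+1})$. For the regular version, let $\pi$ be the projection sending every basis sequence having two equal consecutive vertices to $0$ and fixing the others, let $\partial^{\mathrm{reg}}_m=\pi\circ\partial_m$, $\Omega^{\mathrm{reg}}_m=\{v\in\mathcal{A}_m:\partial^{\mathrm{reg}}_m v\in\mathcal{A}_{m-1}\}$ (again augmented by $\mathbb{Z}$ in degree $-1$); $\vec\beta^{\mathrm{reg}}_k(G)$ is the rank of the $k$-th homology group of this complex. *)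

theory Defs
  imports
    "HOL-Algebra.Free_Abelian_Groups"
    "HOL-Library.Extended_Nat"
    "HOL-Probability.Probability"
    "Graph_Theory.Pair_Digraph"
begin

section \<open>Rank of an abelian group\<close>

definition int_independent :: "('a, 'b) monoid_scheme \<Rightarrow> 'a set \<Rightarrow> bool" where
  "int_independent G S \<longleftrightarrow> finite S \<and> S \<subseteq> carrier G \<and>
     (\<forall>c :: 'a \<Rightarrow> int. finprod G (\<lambda>x. x [^]\<^bsub>G\<^esub> c x) S = \<one>\<^bsub>G\<^esub> \<longrightarrow> (\<forall>x\<in>S. c x = 0))"

text \<open>The rank takes values in \<^typ>\<open>enat\<close>, so that rank 0 really means that there are no
  nonempty independent sets (a supremum in \<^typ>\<open>nat\<close> is meaningless for unbounded sets).\<close>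

definition abelian_rank :: "('a, 'b) monoid_scheme \<Rightarrow> enat" where
  "abelian_rank G = (SUP S\<in>{S. int_independent G S}. enat (card S))"


section \<open>Path homology\<close>

text \<open>
  Degrees are integers. The basis of the chains of degree \<open>m\<close> consists of the lists of length
  \<open>m + 1\<close>. In degree \<open>-1\<close> this is the empty list only, so the free group on it is \<open>\<int>\<close>, and
  the alternating-sum formula for the boundary of \<open>[v]\<close> gives the generator
  \<^term>\<open>frag_of []\<close>, i.e. the boundary in degree 0 is the sum of coefficients (augmentation).
  In degrees below \<open>-1\<close> all groups are trivial.
\<close>

definition vertex_seqs :: "'v pair_pre_digraph \<Rightarrow> int \<Rightarrow> 'v list set" where
  "vertex_seqs G m = {vs. int (length vs) = m + 1 \<and> set vs \<subseteq> pverts G}"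

definition allowed_seqs :: "'v pair_pre_digraph \<Rightarrow> int \<Rightarrow> 'v list set" where
  "allowed_seqs G m = {vs \<in> vertex_seqs G m. successively (\<lambda>u v. (u, v) \<in> parcs G) vs}"

definition allowed_chains :: "'v pair_pre_digraph \<Rightarrow> int \<Rightarrow> ('v list \<Rightarrow>\<^sub>0 int) monoid" where
  "allowed_chains G m = free_Abelian_group (allowed_seqs G m)"

definition path_boundary :: "('v list \<Rightarrow>\<^sub>0 int) \<Rightarrow> ('v list \<Rightarrow>\<^sub>0 int)" where
  "path_boundary = frag_extend (\<lambda>vs.
     \<Sum>i<length vs. frag_cmul ((-1) ^ i) (frag_of (take i vs @ drop (Suc i) vs)))"

definition regular_projection :: "('v list \<Rightarrow>\<^sub>0 int) \<Rightarrow> ('v list \<Rightarrow>\<^sub>0 int)" where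
  "regular_projection = frag_extend (\<lambda>vs. if distinct_adj vs then frag_of vs else 0)"

definition regular_path_boundary :: "('v list \<Rightarrow>\<^sub>0 int) \<Rightarrow> ('v list \<Rightarrow>\<^sub>0 int)" where
  "regular_path_boundary = regular_projection \<circ> path_boundary"

text \<open>The following are parametrised by the boundary map \<open>d\<close>, to be instantiated with
  \<^const>\<open>path_boundary\<close> or \<^const>\<open>regular_path_boundary\<close>.\<close>

definition path_Omega ::
  "(('v list \<Rightarrow>\<^sub>0 int) \<Rightarrow> ('v list \<Rightarrow>\<^sub>0 int)) \<Rightarrow> 'v pair_pre_digraph \<Rightarrow> int \<Rightarrow> ('v list \<Rightarrow>\<^sub>0 int) set"
where
  "path_Omega d G m =
     {c \<in> carrier (allowed_chains G m). d c \<in> carrier (allowed_chains G (m - 1))}"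

definition path_cycles ::
  "(('v list \<Rightarrow>\<^sub>0 int) \<Rightarrow> ('v list \<Rightarrow>\<^sub>0 int)) \<Rightarrow> 'v pair_pre_digraph \<Rightarrow> int \<Rightarrow> ('v list \<Rightarrow>\<^sub>0 int) set"
where
  "path_cycles d G m = {c \<in> path_Omega d G m. d c = 0}"

definition path_homology ::
  "(('v list \<Rightarrow>\<^sub>0 int) \<Rightarrow> ('v list \<Rightarrow>\<^sub>0 int)) \<Rightarrow> 'v pair_pre_digraph \<Rightarrow> int
     \<Rightarrow> ('v list \<Rightarrow>\<^sub>0 int) set monoid"
where
  "path_homology d G m =
     subgroup_generated (allowed_chains G m) (path_cycles d G m) Mod (d ` path_Omega d G (m + 1))"

definition path_betti :: "nat \<Rightarrow> 'v pair_pre_digraph \<Rightarrow> enat" where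
  "path_betti k G = abelian_rank (path_homology path_boundary G (int k))"

definition regular_path_betti :: "nat \<Rightarrow> 'v pair_pre_digraph \<Rightarrow> enat" where
  "regular_path_betti k G = abelian_rank (path_homology regular_path_boundary G (int k))"


section \<open>Random digraphs\<close>

definition possible_arcs :: "nat \<Rightarrow> (nat \<times> nat) set" where
  "possible_arcs n = {(i, j). i \<in> {1..n} \<and> j \<in> {1..n} \<and> i \<noteq> j}"

definition random_digraph :: "nat \<Rightarrow> real \<Rightarrow> nat pair_pre_digraph pmf" where
  "random_digraph n p =
     map_pmf (\<lambda>f. \<lparr>pverts = {1..n}, parcs = {e \<in> possible_arcs n. f e}\<rparr>)
       (Pi_pmf (possible_arcs n) False (\<lambda>_. bernoulli_pmf p))"

text \<open>Every outcome is a simple digraph: \<^locale>\<open>pair_digraph\<close> says finite and loop-free, and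
  parallel arcs are impossible since arcs are pairs.\<close>

lemma random_digraph_simple:
  assumes "G \<in> set_pmf (random_digraph n p)"
  shows "pair_digraph G" "pverts G = {1..n}"
proof -
  have "finite (possible_arcs n)"
    by (rule finite_subset[of _ "{1..n} \<times> {1..n}"]) (auto simp: possible_arcs_def)
  with assms show "pair_digraph G" "pverts G = {1..n}"
    by (auto simp: random_digraph_def possible_arcs_def intro!: pair_digraph.intro
          pair_fin_digraph.intro pair_wf_digraph.intro pair_loopfree_digraph.intro
          pair_fin_digraph_axioms.intro pair_loopfree_digraph_axioms.intro)
qed

end

theory Submission
  imports Defs
begin

text \<open>
  With high probability there is no allowed sequence of \<open>N + 1\<close> vertices at all, so the chain groups
  vanish in every degree \<open>k \<ge> N\<close>. Indeed, such a sequence either has distinct vertices, and the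
  expected number of these is at most \<open>n\<^sup>N\<^sup>+\<^sup>1 p\<^sup>N\<close>, or it contains a directed cycle of length
  \<open>l \<le> N\<close>, and the expected number of these is at most \<open>(np)\<^sup>l\<close>. For \<open>\<alpha> < -(N+1)/N\<close> all these
  expectations tend to 0.
\<close>

section \<open>Vanishing of homology without allowed sequences\<close>

text \<open>A nonempty independent set could only be \<open>{\<one>}\<close>, and the coefficient 1
  there is already a nontrivial relation. The supremum then runs over the empty set alone.\<close>

lemma abelian_rank_trivial_group:
  assumes "comm_group G" and "carrier G = {\<one>\<^bsub>G\<^esub>}"
  shows "abelian_rank G = 0"
proof -
  interpret comm_group G by fact
  have "S = {}" if "int_independent G S" for S
  proof (rule ccontr)
    assume "S \<noteq> {}"
    moreover have "S \<subseteq> {\<one>\<^bsub>G\<^esub>}"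
      using that assms(2) by (auto simp: int_independent_def)
    ultimately have S: "S = {\<one>\<^bsub>G\<^esub>}"
      by auto
    have "finprod G (\<lambda>x. x [^]\<^bsub>G\<^esub> (1 :: int)) S = \<one>\<^bsub>G\<^esub>"
      unfolding S by (subst finprod_insert) auto
    with that have "\<forall>x\<in>S. (1 :: int) = 0"
      unfolding int_independent_def by (elim conjE allE[of _ "\<lambda>_. 1"]) blast
    with S show False
      by simp
  qed
  then have "{S. int_independent G S} \<subseteq> {{}}"
    by blast
  then have "abelian_rank G \<le> (SUP S\<in>{{} :: 'a set}. enat (card S))"
    unfolding abelian_rank_def by (rule SUP_subset_mono) simp
  then show ?thesis
    by (simp add: zero_enat_def[symmetric])
qed

lemma carrier_allowed_chains_empty:
  assumes "allowed_seqs G m = {}"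
  shows "carrier (allowed_chains G m) = {0}"
  using assms by (auto simp: allowed_chains_def carrier_free_Abelian_group_iff)

text \<open>Trivial chain groups in degrees \<open>m\<close> and \<open>m + 1\<close> leave a
  quotient of a trivial group. Keeping \<open>d\<close> abstract serves the regular and non-regular
  boundaries at once.\<close>

lemma abelian_rank_path_homology_eq_0:
  assumes "d 0 = 0" and "allowed_seqs G m = {}" and "allowed_seqs G (m + 1) = {}"
  shows "abelian_rank (path_homology d G m) = 0"
proof -
  let ?C = "allowed_chains G m"
  let ?Z = "subgroup_generated ?C (path_cycles d G m)"
  \<comment> \<open>Here \<open>path_Omega d G (m + 1)\<close> is \<open>{0}\<close>, and 0 is the
    neutral element of the free abelian group.\<close>
  have boundaries: "d ` path_Omega d G (m + 1) = {\<one>\<^bsub>?Z\<^esub>}"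
    using assms by (auto simp: path_Omega_def carrier_allowed_chains_empty)
      (auto simp: allowed_chains_def)
  interpret C: comm_group ?C
    by (simp add: allowed_chains_def abelian_free_Abelian_group)
  interpret Z: comm_group ?Z
    by (rule C.abelian_subgroup_generated) (rule C.comm_group_axioms)
  have zero: "carrier ?Z \<subseteq> {0}"
    using C.carrier_subgroup_generated_subset carrier_allowed_chains_empty[OF assms(2)] by metis
  have "\<one>\<^bsub>?Z\<^esub> = 0"
    using subsetD[OF zero Z.one_closed] by (rule singletonD)
  with zero have carrier: "carrier ?Z = {\<one>\<^bsub>?Z\<^esub>}"
    using Z.one_closed by (intro equalityI) (simp_all only: insert_subset empty_subsetI simp_thms)
  show ?thesis
    unfolding path_homology_def boundaries
  proof (rule abelian_rank_trivial_group)
    show "comm_group (?Z Mod {\<one>\<^bsub>?Z\<^esub>})"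
      by (rule Z.abelian_FactGroup) (rule Z.triv_subgroup)
    show "carrier (?Z Mod {\<one>\<^bsub>?Z\<^esub>}) = {\<one>\<^bsub>?Z Mod {\<one>\<^bsub>?Z\<^esub>}\<^esub>}"
      by (simp only: FactGroup_def RCOSETS_def r_coset_def carrier partial_object.simps monoid.simps
          UN_insert UN_empty Un_empty_right Z.r_one[OF Z.one_closed])
  qed
qed

lemma path_boundary_0: "path_boundary 0 = 0"
  by (simp add: path_boundary_def)

lemma regular_path_boundary_0: "regular_path_boundary 0 = 0"
  by (simp add: regular_path_boundary_def regular_projection_def path_boundary_0)

section \<open>Paths and cycles in long allowed sequences\<close>

lemma zip_tl_subset_of_successively:
  assumes "successively (\<lambda>u v. (u, v) \<in> R) vs"
  shows "set (zip vs (tl vs)) \<subseteq> R"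
  using assms by (induction vs rule: induct_list012) auto

text \<open>Distinct first components make the pairs distinct. Hence a path on N + 1 vertices has N
  arcs, and a cycle on l vertices has l arcs.\<close>

lemma card_zip_distinct:
  assumes "distinct xs"
  shows "card (set (zip xs ys)) = min (length xs) (length ys)"
  using assms by (simp add: distinct_card distinct_zipI1)

text \<open>Stop at the first entry y that repeats an earlier one: the stretch from the earlier y up
  to just before the repetition is duplicate-free and closes up. A single vertex related to itself
  counts as a cycle of length 1.\<close>

lemma successively_distinct_or_cycle:
  assumes "successively P vs" and "\<not> distinct vs"
  obtains ws where "distinct ws" "ws \<noteq> []" "length ws < length vs" "set ws \<subseteq> set vs"
    "successively P (ws @ [hd ws])"
proof -
  from assms(2) obtain xs y zs where xs: "y \<in> set xs" "distinct xs" "vs = xs @ y # zs"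
    by (auto simp: not_distinct_conv_prefix)
  then obtain us ts where "xs = us @ y # ts"
    by (auto simp: in_set_conv_decomp)
  with xs have vs: "vs = us @ (y # ts @ [y]) @ zs" and "distinct (y # ts)"
    by auto
  moreover have "successively P (y # ts @ [y])"
    using assms(1) unfolding vs successively_append_iff by blast
  ultimately show thesis
    by (intro that[of "y # ts"]) auto
qed

lemma cycle_arcs_subset_of_successively:
  assumes "successively (\<lambda>u v. (u, v) \<in> R) (ws @ [hd ws])" and "ws \<noteq> []"
  shows "set (zip ws (rotate1 ws)) \<subseteq> R"
proof -
  from \<open>ws \<noteq> []\<close> obtain y ts where ws: "ws = y # ts"
    by (cases ws) auto
  \<comment> \<open>\<open>zip\<close> drops the closing y of its longer first argument, so the
    steps of the closed walk are exactly the pairs of \<open>zip ws (rotate1 ws)\<close>.\<close>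
  have "zip (y # ts @ [y]) (ts @ [y]) = zip (y # ts) (ts @ [y])"
    using zip_append[of "y # ts" "ts @ [y]" "[y]" "[]"] by simp
  then show ?thesis
    using zip_tl_subset_of_successively[OF assms(1)] by (simp add: ws)
qed

lemma allowed_seq_path_or_cycle:
  assumes "vs \<in> allowed_seqs G k" and "int N \<le> k"
  obtains
    (path) ws where "set ws \<subseteq> pverts G" "length ws = Suc N" "distinct ws"
      "set (zip ws (tl ws)) \<subseteq> parcs G"
  | (cycle) ws where "set ws \<subseteq> pverts G" "length ws \<in> {1..N}" "distinct ws"
      "set (zip ws (rotate1 ws)) \<subseteq> parcs G"
proof -
  \<comment> \<open>\<open>vs\<close> has k + 1 \<ge> N + 1 entries, so this prefix has exactly N +
    1. A cycle found inside it is strictly shorter, hence of length at most N.\<close>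
  define us where "us = take (Suc N) vs"
  have len: "length us = Suc N" and verts: "set us \<subseteq> pverts G"
    using assms set_take_subset[of "Suc N" vs]
    by (auto simp: us_def allowed_seqs_def vertex_seqs_def)
  have "successively (\<lambda>u v. (u, v) \<in> parcs G) (us @ drop (Suc N) vs)"
    using assms by (simp add: us_def allowed_seqs_def)
  then have succ: "successively (\<lambda>u v. (u, v) \<in> parcs G) us"
    by (simp add: successively_append_iff)
  show thesis
  proof (cases "distinct us")
    case True
    then show ?thesis
      using path verts len zip_tl_subset_of_successively[OF succ] by blast
  next
    case False
    with succ obtain ws where ws: "distinct ws" "ws \<noteq> []" "length ws < length us"
      "set ws \<subseteq> set us" "successively (\<lambda>u v. (u, v) \<in> parcs G) (ws @ [hd ws])"
      by (rule successively_distinct_or_cycle)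
    then have "length ws \<in> {1..N}"
      using len by (cases ws) auto
    with ws verts show ?thesis
      by (intro cycle[of ws] cycle_arcs_subset_of_successively) auto
  qed
qed

section \<open>The first moment bound\<close>

lemma finite_possible_arcs: "finite (possible_arcs n)"
  by (rule finite_subset[of _ "{1..n} \<times> {1..n}"]) (auto simp: possible_arcs_def)

text \<open>Independence gives equality when all of \<open>A\<close> consists of possible arcs.
  Otherwise, as for the loop coming from a cycle of length 1, the event has probability 0.\<close>

lemma prob_arcs_subset_le:
  assumes "0 \<le> p" "p \<le> 1"
  shows "measure_pmf.prob (random_digraph n p) {G. A \<subseteq> parcs G} \<le> p ^ card A"
proof (cases "A \<subseteq> possible_arcs n")
  case True
  \<comment> \<open>The event becomes a product set: arcs in \<open>A\<close> are forced to be
    present, all others are free, so the factors are p and 1.\<close>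
  let ?B = "\<lambda>e. if e \<in> A then {True} else UNIV"
  have "measure_pmf.prob (random_digraph n p) {G. A \<subseteq> parcs G} =
      measure_pmf.prob (Pi_pmf (possible_arcs n) False (\<lambda>_. bernoulli_pmf p)) (Pi (possible_arcs n) ?B)"
    using True unfolding random_digraph_def measure_map_pmf
    by (intro arg_cong2[where f = measure_pmf.prob] refl) (auto simp: Pi_def split: if_splits)
  also have "\<dots> = (\<Prod>e\<in>possible_arcs n. measure_pmf.prob (bernoulli_pmf p) (?B e))"
    by (rule measure_Pi_pmf_Pi) (rule finite_possible_arcs)
  also have "\<dots> = (\<Prod>e\<in>possible_arcs n. if e \<in> A then p else 1)"
    using assms by (intro prod.cong refl) (auto simp: measure_pmf_single)
  also have "\<dots> = p ^ card A"
    using True by (simp add: prod.If_cases finite_possible_arcs Int_absorb1)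
  finally show ?thesis
    by simp
next
  case False
  then have "{G. A \<subseteq> parcs G} \<inter> set_pmf (random_digraph n p) = {}"
    by (auto simp: random_digraph_def)
  then have "measure_pmf.prob (random_digraph n p) {G. A \<subseteq> parcs G} = 0"
    by (metis measure_Int_set_pmf measure_empty)
  then show ?thesis
    using assms by simp
qed

lemma prob_exists_arcs_subset_le:
  assumes "0 \<le> p" "p \<le> 1" and "finite I" and "\<And>i. i \<in> I \<Longrightarrow> card (A i) = m"
  shows "measure_pmf.prob (random_digraph n p) (\<Union>i\<in>I. {G. A i \<subseteq> parcs G}) \<le> real (card I) * p ^ m"
proof -
  have "measure_pmf.prob (random_digraph n p) (\<Union>i\<in>I. {G. A i \<subseteq> parcs G}) \<le>
      (\<Sum>i\<in>I. measure_pmf.prob (random_digraph n p) {G. A i \<subseteq> parcs G})"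
    using \<open>finite I\<close> by (intro measure_pmf.finite_measure_subadditive_finite) auto
  also have "\<dots> \<le> (\<Sum>i\<in>I. p ^ m)"
    using prob_arcs_subset_le[OF assms(1,2)] assms(4) by (intro sum_mono) metis
  finally show ?thesis
    by simp
qed

text \<open>Union bound over at most \<open>n ^ l\<close> vertex lists. The arc count
  \<open>m\<close> is kept apart from \<open>l\<close> because paths have \<open>m = l - 1\<close>
  and cycles have \<open>m = l\<close>.\<close>

lemma prob_exists_list_arcs_subset_le:
  fixes A :: "nat list \<Rightarrow> (nat \<times> nat) set"
  assumes "0 \<le> p" "p \<le> 1"
    and "\<And>ws. distinct ws \<Longrightarrow> length ws = l \<Longrightarrow> card (A ws) = m"
  shows "measure_pmf.prob (random_digraph n p)
    (\<Union>ws\<in>{ws. set ws \<subseteq> {1..n} \<and> length ws = l \<and> distinct ws}. {G. A ws \<subseteq> parcs G})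
      \<le> real n ^ l * p ^ m"
proof -
  let ?I = "{ws. set ws \<subseteq> {1..n} \<and> length ws = l \<and> distinct ws}"
  let ?J = "{ws. set ws \<subseteq> {1..n} \<and> length ws = l}"
  have fin: "finite ?J"
    by (rule finite_lists_length_eq) simp
  have sub: "?I \<subseteq> ?J"
    by auto
  have "card ?I \<le> n ^ l"
    using card_mono[OF fin sub] card_lists_length_eq[of "{1..n}" l] by simp
  then have "real (card ?I) * p ^ m \<le> real n ^ l * p ^ m"
    using \<open>0 \<le> p\<close> by (intro mult_right_mono) (simp_all flip: of_nat_power)
  moreover have "measure_pmf.prob (random_digraph n p) (\<Union>ws\<in>?I. {G. A ws \<subseteq> parcs G})
      \<le> real (card ?I) * p ^ m"
    using assms finite_subset[OF sub fin] by (intro prob_exists_arcs_subset_le) auto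
  ultimately show ?thesis
    by linarith
qed

lemma prob_allowed_seqs_nonempty_le:
  assumes "0 \<le> p" "p \<le> 1" and "int N \<le> k"
  shows "measure_pmf.prob (random_digraph n p) {G. allowed_seqs G k \<noteq> {}}
    \<le> real n ^ Suc N * p ^ N + (\<Sum>l\<in>{1..N}. real n ^ l * p ^ l)"
proof -
  let ?M = "random_digraph n p"
  let ?I = "\<lambda>l. {ws. set ws \<subseteq> {1..n} \<and> length ws = l \<and> distinct ws}"
  let ?P = "\<Union>ws\<in>?I (Suc N). {G. set (zip ws (tl ws)) \<subseteq> parcs G}"
  let ?C = "\<lambda>l. \<Union>ws\<in>?I l. {G. set (zip ws (rotate1 ws)) \<subseteq> parcs G}"
  \<comment> \<open>The inclusion is claimed only on the support, where the vertex set is known to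
    be \<open>{1..n}\<close>; monotonicity is therefore applied almost everywhere.\<close>
  have "G \<in> ?P \<union> (\<Union>l\<in>{1..N}. ?C l)"
    if "G \<in> set_pmf ?M" "allowed_seqs G k \<noteq> {}" for G
  proof -
    from that(2) obtain vs where "vs \<in> allowed_seqs G k"
      by blast
    then show ?thesis
      using assms(3) random_digraph_simple(2)[OF that(1)]
      by (cases rule: allowed_seq_path_or_cycle) auto
  qed
  then have "measure_pmf.prob ?M {G. allowed_seqs G k \<noteq> {}}
      \<le> measure_pmf.prob ?M (?P \<union> (\<Union>l\<in>{1..N}. ?C l))"
    by (intro measure_pmf.finite_measure_mono_AE) (auto simp: AE_measure_pmf_iff)
  also have "\<dots> \<le> measure_pmf.prob ?M ?P + measure_pmf.prob ?M (\<Union>l\<in>{1..N}. ?C l)"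
    by (rule measure_Un_le) auto
  also have "\<dots> \<le> measure_pmf.prob ?M ?P + (\<Sum>l\<in>{1..N}. measure_pmf.prob ?M (?C l))"
    by (intro add_left_mono measure_pmf.finite_measure_subadditive_finite) auto
  also have "\<dots> \<le> real n ^ Suc N * p ^ N + (\<Sum>l\<in>{1..N}. real n ^ l * p ^ l)"
    using assms(1,2)
    by (intro add_mono sum_mono prob_exists_list_arcs_subset_le) (simp_all add: card_zip_distinct)
  finally show ?thesis .
qed

section \<open>Asymptotics for p = n^\<alpha>\<close>

lemma power_mult_powr_power_tendsto_0:
  fixes \<alpha> :: real
  assumes "real a + \<alpha> * real b < 0"
  shows "(\<lambda>n. real n ^ a * (real n powr \<alpha>) ^ b) \<longlonglongrightarrow> 0"
proof -
  have "(\<lambda>n. real n powr (real a + \<alpha> * real b)) \<longlonglongrightarrow> 0"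
    using assms filterlim_real_sequentially by (rule tendsto_neg_powr)
  moreover have "\<forall>\<^sub>F n in sequentially.
      real n powr (real a + \<alpha> * real b) = real n ^ a * (real n powr \<alpha>) ^ b"
    using eventually_gt_at_top[of 0]
    by eventually_elim (simp add: powr_add powr_realpow powr_power mult.commute)
  ultimately show ?thesis
    by (rule Lim_transform_eventually)
qed

lemma prob_allowed_seqs_empty_tendsto_1:
  fixes \<alpha> :: real
  assumes "N \<ge> 1" and "\<alpha> < - ((real N + 1) / real N)" and "int N \<le> k"
  shows "(\<lambda>n. measure_pmf.prob (random_digraph n (real n powr \<alpha>)) {G. allowed_seqs G k = {}})
    \<longlonglongrightarrow> 1"
proof (rule tendsto_sandwich[where h = "\<lambda>_. 1"])
  let ?b = "\<lambda>n. real n ^ Suc N * (real n powr \<alpha>) ^ N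
    + (\<Sum>l\<in>{1..N}. real n ^ l * (real n powr \<alpha>) ^ l)"
  \<comment> \<open>This is the hypothesis on \<alpha> multiplied by N.\<close>
  have path: "real (Suc N) + \<alpha> * real N < 0"
    using assms(1,2) by (simp add: field_simps)
  \<comment> \<open>The same hypothesis forces \<alpha> < -1, so every cycle exponent l (1 +
    \<alpha>) is negative.\<close>
  have "1 \<le> (real N + 1) / real N"
    using assms(1) by simp
  then have "\<alpha> < - 1"
    using assms(2) by linarith
  then have cycle: "real l + \<alpha> * real l < 0" if "l \<in> {1..N}" for l
    using that mult_strict_right_mono[of \<alpha> "- 1" "real l"] by simp
  have "?b \<longlonglongrightarrow> 0 + (\<Sum>l\<in>{1..N}. 0)"
    by (intro tendsto_add tendsto_sum power_mult_powr_power_tendsto_0 path cycle)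
  then show "(\<lambda>n. 1 - ?b n) \<longlonglongrightarrow> 1"
    using tendsto_diff[OF tendsto_const[of 1]] by fastforce
  show "\<forall>\<^sub>F n in sequentially. 1 - ?b n \<le>
      measure_pmf.prob (random_digraph n (real n powr \<alpha>)) {G. allowed_seqs G k = {}}"
    using eventually_gt_at_top[of 0]
  proof eventually_elim
    case (elim n)
    let ?M = "random_digraph n (real n powr \<alpha>)"
    \<comment> \<open>For n \<ge> 1 the negative exponent gives p \<le> 1, as the first moment bound
      requires.\<close>
    have "real n powr \<alpha> \<le> real n powr 0"
      using elim \<open>\<alpha> < - 1\<close> by (intro powr_mono) auto
    then have "measure_pmf.prob ?M {G. allowed_seqs G k \<noteq> {}} \<le> ?b n"
      using elim assms(3) by (intro prob_allowed_seqs_nonempty_le) auto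
    moreover have "measure_pmf.prob ?M {G. allowed_seqs G k \<noteq> {}}
        = 1 - measure_pmf.prob ?M {G. allowed_seqs G k = {}}"
      using measure_pmf.prob_compl[of "{G. allowed_seqs G k = {}}" ?M]
      by (simp add: Compl_eq_Diff_UNIV[symmetric] Collect_neg_eq[symmetric])
    ultimately show ?case
      by linarith
  qed
qed (auto intro: always_eventually)

text \<open>Deleting the first vertex of an allowed sequence leaves an allowed one. This handles
  degree k + 1, whose boundaries enter the homology in degree k.\<close>

lemma allowed_seqs_Suc_empty:
  assumes "allowed_seqs G (int k) = {}"
  shows "allowed_seqs G (int k + 1) = {}"
proof (rule ccontr)
  assume "allowed_seqs G (int k + 1) \<noteq> {}"
  then obtain vs where "vs \<in> allowed_seqs G (int k + 1)"
    by blast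
  then have "tl vs \<in> allowed_seqs G (int k)"
    by (cases vs) (auto simp: allowed_seqs_def vertex_seqs_def successively_Cons)
  with assms show False
    by simp
qed

theorem theorem1p4:
  fixes N k :: nat and \<alpha> :: real
  assumes "N \<ge> 1" and "\<alpha> < - ((real N + 1) / real N)" and "k \<ge> N"
  shows "((\<lambda>n. measure_pmf.prob (random_digraph n (real n powr \<alpha>)) {G. path_betti k G = 0})
            \<longlonglongrightarrow> 1) \<and>
         ((\<lambda>n. measure_pmf.prob (random_digraph n (real n powr \<alpha>)) {G. regular_path_betti k G = 0})
            \<longlonglongrightarrow> 1)"
proof -
  have lim: "(\<lambda>n. measure_pmf.prob (random_digraph n (real n powr \<alpha>))
        {G. abelian_rank (path_homology d G (int k)) = 0})
      \<longlonglongrightarrow> 1"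
    if "d 0 = 0" for d :: "(nat list \<Rightarrow>\<^sub>0 int) \<Rightarrow> (nat list \<Rightarrow>\<^sub>0 int)"
  proof (rule tendsto_sandwich[where h = "\<lambda>_. 1"])
    show "(\<lambda>n. measure_pmf.prob (random_digraph n (real n powr \<alpha>)) {G. allowed_seqs G (int k) = {}})
        \<longlonglongrightarrow> 1"
      using assms by (intro prob_allowed_seqs_empty_tendsto_1[of N]) auto
    \<comment> \<open>The vanishing argument holds for every digraph, so this is a plain inclusion
      of events and the limit 1 passes to the larger one.\<close>
    have "{G. allowed_seqs G (int k) = {}} \<subseteq> {G. abelian_rank (path_homology d G (int k)) = 0}"
      using that abelian_rank_path_homology_eq_0 allowed_seqs_Suc_empty by blast
    then show "\<forall>\<^sub>F n in sequentially.
        measure_pmf.prob (random_digraph n (real n powr \<alpha>)) {G. allowed_seqs G (int k) = {}}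
        \<le> measure_pmf.prob (random_digraph n (real n powr \<alpha>))
            {G. abelian_rank (path_homology d G (int k)) = 0}"
      by (intro always_eventually allI measure_pmf.finite_measure_mono) auto
  qed (auto intro: always_eventually)
  show ?thesis
    unfolding path_betti_def regular_path_betti_def
    using lim path_boundary_0 regular_path_boundary_0 by blast
qed

end
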